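(* Let $R_n(x)=\sum_{k=0}^{n-1} c_n(k)x^k$. Then $R_2(-1)=2$, and (i) $R_n(-1)=\varphi(n)$ for every odd $n\ge 1$; (ii) $R_n(-1)=0$ for every even $n>2$; (iii) for every $n\ge 1$, the $n$th cyclotomic polynomial $\Phi_n(x)$ divides the polynomial $R_n(x)-n$.
   Context: For integers $n\ge 1$ and $k$, the Ramanujan sum is $c_n(k)=\sum_{1\le j\le n,\ \gcd(j,n)=1} e^{2\pi i jk/n}$. $\varphi$ is Euler's totient function and $\Phi_n(x)=\prod_{1\le j\le n,\ \gcd(j,n)=1}(x-e^{2\pi i j/n})$ is the $n$th cyclotomic polynomial. *)

theory Defs
  imports Complex_Main
    "HOL-Computational_Algebra.Polynomial"
    "HOL-Number_Theory.Totient"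
begin

definition ramanujan_sum :: "nat \<Rightarrow> int \<Rightarrow> complex" where
  "ramanujan_sum n k =
     (\<Sum>j | 1 \<le> j \<and> j \<le> n \<and> coprime j n.
        exp (2 * complex_of_real pi * \<i> * of_nat j * of_int k / of_nat n))"

definition cyclotomic_poly :: "nat \<Rightarrow> complex poly" where
  "cyclotomic_poly n =
     (\<Prod>j | 1 \<le> j \<and> j \<le> n \<and> coprime j n.
        [:- exp (2 * complex_of_real pi * \<i> * of_nat j / of_nat n), 1:])"

definition ramanujan_poly :: "nat \<Rightarrow> complex poly" where
  "ramanujan_poly n = (\<Sum>k<n. monom (ramanujan_sum n (int k)) k)"

end

theory Submission
  imports Defs "HOL-Analysis.Complex_Transcendental"
begin

text \<open>
  Exchanging the two sums, the value of the Ramanujan polynomial at x is a sum of geometric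
  sums of w x, over the primitive n-th roots of unity w. If x is itself an n-th root of unity,
  only the term with w x = 1 survives, and it occurs exactly when x is primitive. This yields
  the divisibility by the cyclotomic polynomial and, since -1 is an n-th root of unity for even n,
  the values at -1 for even n. For odd n the geometric sum at x = -1 equals 2 / (1 + w), and
  the terms belonging to w and 1 / w add up to 2.
\<close>

text \<open>The index \<open>j\<close> is an arbitrary natural number, so products and powers of
  roots become sums and multiples of indices.\<close>

definition unity_root :: "nat \<Rightarrow> nat \<Rightarrow> complex" where
  "unity_root n j = exp (2 * complex_of_real pi * \<i> * of_nat j / of_nat n)"

lemma unity_root_add: "unity_root n (i + j) = unity_root n i * unity_root n j"
  by (simp add: unity_root_def exp_add [symmetric] add_divide_distrib [symmetric] ring_distribs)

lemma unity_root_eq_1_iff: "n \<ge> 1 \<Longrightarrow> unity_root n j = 1 \<longleftrightarrow> n dvd j"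
  unfolding unity_root_def by (rule complex_root_unity_eq_1)

lemma unity_root_eq_iff:
  "n \<ge> 1 \<Longrightarrow> unity_root n i = unity_root n j \<longleftrightarrow> i mod n = j mod n"
  unfolding unity_root_def by (simp add: complex_root_unity_eq cong_def)

lemma unity_root_power: "unity_root n j ^ k = unity_root n (j * k)"
  by (simp add: unity_root_def exp_of_nat_mult [symmetric] mult_ac)

lemma unity_root_half: "m \<ge> 1 \<Longrightarrow> unity_root (2 * m) m = -1"
  by (simp add: unity_root_def)

lemma sum_powers_unity_root:
  assumes "n \<ge> 1"
  shows "(\<Sum>k<n. unity_root n j ^ k) = (if n dvd j then of_nat n else 0)"
proof (cases "n dvd j")
  case True
  then show ?thesis
    using assms by (simp add: unity_root_eq_1_iff [THEN iffD2])
next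
  case False
  then have "unity_root n j \<noteq> 1"
    using assms by (simp add: unity_root_eq_1_iff)
  moreover have "unity_root n j ^ n = 1"
    using assms by (simp add: unity_root_power unity_root_eq_1_iff)
  ultimately show ?thesis
    using False by (simp add: geometric_sum)
qed

lemma ramanujan_sum_altdef:
  "ramanujan_sum n (int k) =
     (\<Sum>j | 1 \<le> j \<and> j \<le> n \<and> coprime j n. unity_root n j ^ k)"
  unfolding ramanujan_sum_def unity_root_power by (simp add: unity_root_def mult_ac)

lemma cyclotomic_poly_altdef:
  "cyclotomic_poly n =
     (\<Prod>j | 1 \<le> j \<and> j \<le> n \<and> coprime j n. [:- unity_root n j, 1:])"
  by (simp add: cyclotomic_poly_def unity_root_def)

lemma poly_ramanujan_poly:
  "poly (ramanujan_poly n) x =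
     (\<Sum>j | 1 \<le> j \<and> j \<le> n \<and> coprime j n. \<Sum>k<n. (unity_root n j * x) ^ k)"
  by (simp add: ramanujan_poly_def poly_sum poly_monom ramanujan_sum_altdef sum_distrib_right
      power_mult_distrib sum.swap [of _ _ "{..<n}"])

text \<open>If \<open>n\<close> divides \<open>j + m\<close>, then \<open>j\<close> and
  \<open>m\<close> have the same gcd with \<open>n\<close>, so \<open>j\<close> is coprime to
  \<open>n\<close> exactly when \<open>m\<close> is. The class of \<open>-m\<close> modulo
  \<open>n\<close> has one representative between 1 and \<open>n\<close>; it is \<open>n\<close>
  itself when \<open>n\<close> divides \<open>m\<close>.\<close>

lemma coprime_residues_dvd_add:
  fixes n m :: nat
  assumes "n \<ge> 1"
  shows "{j. 1 \<le> j \<and> j \<le> n \<and> coprime j n \<and> n dvd j + m} =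
     (if coprime m n then {n - m mod n} else {})"
proof -
  have "coprime j n \<longleftrightarrow> coprime m n" if "n dvd j + m" for j
  proof -
    have "gcd j n = gcd m n"
    proof (rule dvd_antisym)
      have "gcd j n dvd j + m"
        using that by (meson dvd_trans gcd_dvd2)
      then show "gcd j n dvd gcd m n"
        by (simp add: dvd_add_right_iff)
      have "gcd m n dvd j + m"
        using that by (meson dvd_trans gcd_dvd2)
      then show "gcd m n dvd gcd j n"
        by (simp add: dvd_add_left_iff)
    qed
    then show ?thesis
      by (simp add: coprime_iff_gcd_eq_1)
  qed
  moreover have "1 \<le> j \<and> j \<le> n \<and> n dvd j + m \<longleftrightarrow> j = n - m mod n" for j
  proof -
    have lt: "m mod n < n"
      using assms by simp
    have red: "n dvd j + m \<longleftrightarrow> n dvd j + m mod n"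
      by (simp add: dvd_eq_mod_eq_0 mod_add_right_eq)
    have "j + m mod n = n" if "1 \<le> j" "j \<le> n" "n dvd j + m mod n"
    proof -
      obtain q where q: "j + m mod n = n * q"
        using \<open>n dvd j + m mod n\<close> by blast
      \<comment> \<open>A positive multiple of \<open>n\<close> below \<open>2 * n\<close> must be
        \<open>n\<close>.\<close>
      have "0 < n * q" "n * q < n * 2"
        using q that lt by linarith+
      then have "q = 1"
        by simp
      with q show ?thesis by simp
    qed
    then show ?thesis
      unfolding red using lt by auto
  qed
  ultimately show ?thesis
    by (cases "coprime m n") (simp_all, blast+)
qed

text \<open>The inner geometric sum for \<open>j\<close> has ratio
  \<open>unity_root n (j + m)\<close>, hence is \<open>n\<close> or 0; at most one \<open>j\<close>
  contributes \<open>n\<close>.\<close>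

lemma poly_ramanujan_poly_unity_root:
  assumes "n \<ge> 1"
  shows "poly (ramanujan_poly n) (unity_root n m) = (if coprime m n then of_nat n else 0)"
proof -
  let ?A = "{j. 1 \<le> j \<and> j \<le> n \<and> coprime j n}"
  have fin: "finite ?A"
    by simp
  have "poly (ramanujan_poly n) (unity_root n m) =
      (\<Sum>j\<in>?A. if n dvd j + m then of_nat n else 0)"
    by (simp add: poly_ramanujan_poly unity_root_add [symmetric] sum_powers_unity_root assms)
  also have "\<dots> = (\<Sum>j | j \<in> ?A \<and> n dvd j + m. of_nat n)"
    using fin by (subst sum.inter_filter) auto
  also have "{j. j \<in> ?A \<and> n dvd j + m} = (if coprime m n then {n - m mod n} else {})"
    using coprime_residues_dvd_add [OF assms, of m] by simp
  finally show ?thesis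
    by simp
qed

lemma poly_ramanujan_poly_minus_1_odd:
  assumes "odd n"
  shows "poly (ramanujan_poly n) (-1) = of_nat (totient n)"
proof (cases "n = 1")
  case True
  then show ?thesis
    by (simp add: poly_ramanujan_poly cong: conj_cong)
next
  case False
  let ?A = "{j. 1 \<le> j \<and> j \<le> n \<and> coprime j n}"
  have n: "n > 1"
    using assms False by (cases n) auto
  \<comment> \<open>This keeps \<open>n - j\<close> in the range 1 to \<open>n\<close> in the
    reflection below. It fails for \<open>n = 1\<close>, where \<open>j = n\<close> is the only
    index.\<close>
  have less: "j < n" if "j \<in> ?A" for j
    using that n by (cases "j = n") auto
  have root: "unity_root n j ^ n = 1" for j
    using n by (simp add: unity_root_power unity_root_eq_1_iff)
  \<comment> \<open>For odd \<open>n\<close>, -1 is not an \<open>n\<close>-th root of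
    unity.\<close>
  have nz: "1 + unity_root n j \<noteq> 0" for j
  proof
    assume "1 + unity_root n j = 0"
    then have "unity_root n j = -1"
      by (simp add: add_eq_0_iff)
    with root [of j] assms show False
      by simp
  qed
  have "(\<Sum>k<n. (unity_root n j * (-1)) ^ k) = 2 / (1 + unity_root n j)" for j
  proof -
    have ne: "- unity_root n j \<noteq> 1"
      using nz [of j] by (metis left_minus)
    then have "(\<Sum>k<n. (- unity_root n j) ^ k) = ((- unity_root n j) ^ n - 1) / (- unity_root n j - 1)"
      by (rule geometric_sum)
    also have "(- unity_root n j) ^ n = -1"
      using assms root [of j] by simp
    also have "(-1 - 1) / (- unity_root n j - 1) = 2 / (1 + unity_root n j)"
      using nz [of j] ne by (subst frac_eq_eq) simp_all
    finally show ?thesis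
      by simp
  qed
  then have eq: "poly (ramanujan_poly n) (-1) = (\<Sum>j\<in>?A. 2 / (1 + unity_root n j))"
    by (simp add: poly_ramanujan_poly)
  \<comment> \<open>Reflecting \<open>j\<close> to \<open>n - j\<close> replaces each root by its
    inverse; adding both forms of the sum pairs the terms.\<close>
  also have "\<dots> = (\<Sum>j\<in>?A. 2 / (1 + unity_root n (n - j)))"
  proof (rule sum.reindex_bij_witness [of _ "\<lambda>j. n - j" "\<lambda>j. n - j"])
    fix j assume j: "j \<in> ?A"
    have "coprime (n - j) n"
      using j by (simp add: coprime_iff_gcd_eq_1 gcd_diff2_nat)
    then show "n - j \<in> ?A" "n - j \<in> ?A"
      using less [OF j] by auto
  qed (auto dest: less)
  finally have "2 * poly (ramanujan_poly n) (-1) =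
      (\<Sum>j\<in>?A. 2 / (1 + unity_root n j) + 2 / (1 + unity_root n (n - j)))"
    using eq by (simp add: sum.distrib)
  also have "\<dots> = (\<Sum>j\<in>?A. 2)"
  proof (rule sum.cong [OF refl])
    fix j assume "j \<in> ?A"
    then have "unity_root n j * unity_root n (n - j) = 1"
      using n by (simp add: unity_root_add [symmetric] unity_root_eq_1_iff)
    \<comment> \<open>With \<open>w * v = 1\<close>, both \<open>2 + w + v\<close> and
      \<open>(1 + w) * (1 + v)\<close> are equal.\<close>
    then show "2 / (1 + unity_root n j) + 2 / (1 + unity_root n (n - j)) = 2"
      using nz [of j] nz [of "n - j"] by (simp add: divide_simps) (simp add: algebra_simps)
  qed
  also have "\<dots> = 2 * of_nat (totient n)"
  proof -
    have "?A = totatives n"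
      by (auto simp: totatives_def)
    then show ?thesis
      by (simp add: totient_def)
  qed
  finally show ?thesis
    by simp
qed

text \<open>Induction on \<open>A\<close>: by injectivity the product over the old roots does not
  vanish at the new root \<open>f a\<close>, so the cofactor \<open>q\<close> does, and it yields
  the next linear factor.\<close>

lemma prod_linear_factors_dvd:
  fixes p :: "'a :: idom poly"
  assumes "finite A" "inj_on f A" "\<And>a. a \<in> A \<Longrightarrow> poly p (f a) = 0"
  shows "(\<Prod>a\<in>A. [:- f a, 1:]) dvd p"
  using assms
proof (induction A rule: finite_induct)
  case (insert a A)
  then obtain q where q: "p = (\<Prod>a\<in>A. [:- f a, 1:]) * q"
    by auto
  have "poly (\<Prod>a\<in>A. [:- f a, 1:]) (f a) \<noteq> 0"
    using insert by (auto simp: poly_prod)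
  moreover have "poly p (f a) = 0"
    using insert by simp
  ultimately have "poly q (f a) = 0"
    by (simp add: q)
  then have "[:- f a, 1:] dvd q"
    by (simp add: poly_eq_0_iff_dvd)
  then show ?case
    using insert.hyps by (simp add: q mult.commute mult_dvd_mono del: mult_pCons_left)
qed simp

lemma cyclotomic_poly_dvd_ramanujan_poly_minus:
  assumes "n \<ge> 1"
  shows "cyclotomic_poly n dvd ramanujan_poly n - of_nat n"
  unfolding cyclotomic_poly_altdef
proof (rule prod_linear_factors_dvd)
  let ?A = "{j. 1 \<le> j \<and> j \<le> n \<and> coprime j n}"
  show "inj_on (unity_root n) ?A"
  proof (rule inj_onI)
    fix i j assume ij: "i \<in> ?A" "j \<in> ?A" and "unity_root n i = unity_root n j"
    then have "i mod n = j mod n"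
      using assms by (simp add: unity_root_eq_iff)
    \<comment> \<open>Reduction modulo \<open>n\<close> fixes every index except \<open>n\<close>,
      which goes to 0, a value no other index takes.\<close>
    with ij show "i = j"
      by (cases "i = n"; cases "j = n") auto
  qed
  show "poly (ramanujan_poly n - of_nat n) (unity_root n j) = 0" if "j \<in> ?A" for j
    using that assms by (simp add: poly_ramanujan_poly_unity_root)
qed simp

theorem theorem4:
  shows "poly (ramanujan_poly 2) (-1) = 2 \<and>
    (\<forall>n::nat. n \<ge> 1 \<and> odd n \<longrightarrow> poly (ramanujan_poly n) (-1) = of_nat (totient n)) \<and>
    (\<forall>n::nat. n > 2 \<and> even n \<longrightarrow> poly (ramanujan_poly n) (-1) = 0) \<and>
    (\<forall>n::nat. n \<ge> 1 \<longrightarrow> cyclotomic_poly n dvd (ramanujan_poly n - of_nat n))"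
proof -
  \<comment> \<open>Here -1 is the root of index \<open>m\<close> for order \<open>2 * m\<close>,
    and \<open>m\<close> is coprime to \<open>2 * m\<close> only for \<open>m = 1\<close>.\<close>
  have even: "poly (ramanujan_poly (2 * m)) (-1) = (if m = 1 then 2 else 0)" if "m \<ge> 1" for m
    using poly_ramanujan_poly_unity_root [of "2 * m" m] that by (simp add: unity_root_half)
  have "poly (ramanujan_poly 2) (-1) = 2"
    using even [of 1] by simp
  moreover have "poly (ramanujan_poly n) (-1) = 0" if "n > 2" "even n" for n
    using that even by (auto elim!: evenE)
  ultimately show ?thesis
    by (simp add: poly_ramanujan_poly_minus_1_odd cyclotomic_poly_dvd_ramanujan_poly_minus)
qed

end
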